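(* Let $n\ge 3$ and let $D_{2n}=\langle x,y \mid y^n=x^2=1,\ xyx^{-1}=y^{-1}\rangle$ be the dihedral group of order $2n$. Then \[ \gamma(\Gamma_c(D_{2n})) = \begin{cases} \gamma(K_{n-2}) & \text{if } n \text{ is even},\\ \gamma(K_{n-1}) & \text{if } n \text{ is odd}.\end{cases}\]
   Context: For a non-abelian group $G$ with center $Z(G)$, the commuting graph $\Gamma_c(G)$ is the simple undirected graph with vertex set $G\setminus Z(G)$, in which two distinct vertices $x,y$ are adjacent if and only if $xy=yx$. The genus $\gamma(\Gamma)$ of a graph $\Gamma$ is the smallest non-negative integer $n$ such that $\Gamma$ can be embedded on the surface obtained by attaching $n$ handles to a sphere. $K_m$ denotes the complete graph on $m$ vertices. *)

theory Defs
  imports "HOL-Analysis.Analysis" "HOL-Algebra.Group"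
begin

section \<open>Groups given by generators and relations\<close>

text \<open>The letter \<open>(g, True)\<close> stands for the generator \<open>g\<close>, the letter \<open>(g, False)\<close> for its
  formal inverse. A relation \<open>r = s\<close> is the pair \<open>(r, s)\<close> of words.\<close>

type_synonym 'g word = "('g \<times> bool) list"

inductive word_eq :: "('g word \<times> 'g word) set \<Rightarrow> 'g word \<Rightarrow> 'g word \<Rightarrow> bool"
  for R :: "('g word \<times> 'g word) set" where
  refl: "word_eq R u u"
| sym: "word_eq R u v \<Longrightarrow> word_eq R v u"
| trans: "word_eq R u v \<Longrightarrow> word_eq R v w \<Longrightarrow> word_eq R u w"
| cancel: "word_eq R (u @ [(g, b), (g, \<not> b)] @ v) (u @ v)"
| relation: "(r, s) \<in> R \<Longrightarrow> word_eq R (u @ r @ v) (u @ s @ v)"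

definition presented_group :: "('g word \<times> 'g word) set \<Rightarrow> 'g word set monoid" where
  "presented_group R =
    \<lparr>carrier = UNIV // {(u, v). word_eq R u v},
     mult = (\<lambda>A B. {w. \<exists>u\<in>A. \<exists>v\<in>B. word_eq R (u @ v) w}),
     one = {w. word_eq R [] w}\<rparr>"

lemma word_eq_equiv: "equiv UNIV {(u, v). word_eq R u v}"
  by (rule equivI) (auto simp: refl_on_def sym_on_def trans_on_def
      intro: word_eq.refl word_eq.sym word_eq.trans)

lemma word_eq_context: "word_eq R u v \<Longrightarrow> word_eq R (a @ u @ b) (a @ v @ b)"
proof (induction rule: word_eq.induct)
  case (cancel u g c v)
  show ?case using word_eq.cancel[of R "a @ u" g c "v @ b"] by simp
next
  case (relation r s u v)
  then show ?case using word_eq.relation[of r s R "a @ u" "v @ b"] by simp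
qed (blast intro: word_eq.refl word_eq.sym word_eq.trans)+

lemma word_eq_append: "word_eq R u u' \<Longrightarrow> word_eq R v v' \<Longrightarrow> word_eq R (u @ v) (u' @ v')"
  using word_eq_context[of R u u' "[]" v] word_eq_context[of R v v' u' "[]"]
  by (auto intro: word_eq.trans)

abbreviation word_class :: "('g word \<times> 'g word) set \<Rightarrow> 'g word \<Rightarrow> 'g word set" where
  "word_class R u \<equiv> {w. word_eq R u w}"

lemma carrier_presented_group: "carrier (presented_group R) = range (word_class R)"
  by (auto simp: presented_group_def quotient_def)

lemma mult_presented_group:
  "word_class R u \<otimes>\<^bsub>presented_group R\<^esub> word_class R v = word_class R (u @ v)"
  by (auto simp: presented_group_def intro: word_eq.refl word_eq.trans word_eq_append)

lemma one_presented_group: "\<one>\<^bsub>presented_group R\<^esub> = word_class R []"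
  by (simp add: presented_group_def)

lemma word_class_eqI: "word_eq R u v \<Longrightarrow> word_class R u = word_class R v"
  by (auto intro: word_eq.sym word_eq.trans)

lemma word_eq_left_inverse: "word_eq R (rev (map (\<lambda>(g, b). (g, \<not> b)) u) @ u) []"
proof (induction u)
  case (Cons l u)
  obtain g b where "l = (g, b)" by force
  then show ?case
    using word_eq.cancel[of R "rev (map (\<lambda>(g, b). (g, \<not> b)) u)" g "\<not> b" u] Cons
    by (auto intro: word_eq.trans)
qed (simp add: word_eq.refl)

lemma group_presented_group: "group (presented_group R)"
proof (rule groupI)
  fix A assume "A \<in> carrier (presented_group R)"
  then obtain u where A: "A = word_class R u" by (auto simp: carrier_presented_group)
  have "word_class R (rev (map (\<lambda>(g, b). (g, \<not> b)) u)) \<otimes>\<^bsub>presented_group R\<^esub> A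
      = \<one>\<^bsub>presented_group R\<^esub>"
    unfolding A mult_presented_group one_presented_group
    by (rule word_class_eqI) (rule word_eq_left_inverse)
  then show "\<exists>B\<in>carrier (presented_group R). B \<otimes>\<^bsub>presented_group R\<^esub> A = \<one>\<^bsub>presented_group R\<^esub>"
    by (auto simp: carrier_presented_group)
qed (auto simp: carrier_presented_group mult_presented_group one_presented_group)

section \<open>The dihedral group\<close>

datatype dihedral_gen = X | Y

abbreviation gen :: "'g \<Rightarrow> 'g word" where "gen g \<equiv> [(g, True)]"
abbreviation gen_inv :: "'g \<Rightarrow> 'g word" where "gen_inv g \<equiv> [(g, False)]"

text \<open>The parameter is \<open>n\<close>, not the order \<open>2 * n\<close> of the group.\<close>

definition dihedral_group :: "nat \<Rightarrow> dihedral_gen word set monoid" where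
  "dihedral_group n = presented_group
    {(concat (replicate n (gen Y)), []),
     (gen X @ gen X, []),
     (gen X @ gen Y @ gen_inv X, gen_inv Y)}"

section \<open>Commuting graphs and complete graphs\<close>

text \<open>A simple graph is a pair of a vertex set and a set of edges, which are two-element sets of
  vertices.\<close>

type_synonym 'a ugraph = "'a set \<times> 'a set set"

definition group_center :: "('a, 'b) monoid_scheme \<Rightarrow> 'a set" where
  "group_center G =
    {z \<in> carrier G. \<forall>g\<in>carrier G. z \<otimes>\<^bsub>G\<^esub> g = g \<otimes>\<^bsub>G\<^esub> z}"

definition commuting_graph :: "('a, 'b) monoid_scheme \<Rightarrow> 'a ugraph" where
  "commuting_graph G =
    (carrier G - group_center G,
     {{x, y} | x y. x \<in> carrier G - group_center G \<and> y \<in> carrier G - group_center G \<and>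
        x \<noteq> y \<and> x \<otimes>\<^bsub>G\<^esub> y = y \<otimes>\<^bsub>G\<^esub> x})"

definition complete_graph :: "nat \<Rightarrow> nat ugraph" where
  "complete_graph m = ({..<m}, {{i, j} | i j. i < m \<and> j < m \<and> i \<noteq> j})"

section \<open>Genus\<close>

text \<open>The sphere with \<open>g\<close> handles as a subset of three-space, a point being a horizontal complex
  coordinate together with a height. The sphere of radius \<open>g + 1\<close> is pierced by \<open>g\<close> vertical
  cylinders of radius \<open>1/2\<close>, whose axes pass through the points \<open>1 - g, 3 - g, \<dots>, g - 1\<close> of the
  real line, so that the closed cylinders are pairwise disjoint. Each cylinder cuts two open
  discs out of the sphere, which are removed; the part of the lateral surface of the cylinder
  inside the ball is the handle attached to their two boundary circles.\<close>

definition handle_axis :: "nat \<Rightarrow> nat \<Rightarrow> complex" where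
  "handle_axis g k = of_real (2 * real k + 1 - real g)"

definition sphere_with_handles :: "nat \<Rightarrow> (complex \<times> real) set" where
  "sphere_with_handles g =
    (sphere 0 (real g + 1) - (\<Union>k<g. ball (handle_axis g k) (1/2) \<times> UNIV)) \<union>
    (\<Union>k<g. (sphere (handle_axis g k) (1/2) \<times> UNIV) \<inter> cball 0 (real g + 1))"

text \<open>An embedding of a finite graph: vertices go to distinct points and edges to arcs joining
  their ends, where an arc meets the vertices and the other arcs in common ends only.\<close>

definition embeds_in :: "'a ugraph \<Rightarrow> 'b::topological_space set \<Rightarrow> bool" where
  "embeds_in \<Gamma> S \<longleftrightarrow> (\<exists>(p :: 'a \<Rightarrow> 'b) (c :: 'a set \<Rightarrow> real \<Rightarrow> 'b).
     inj_on p (fst \<Gamma>) \<and> p ` fst \<Gamma> \<subseteq> S \<and>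
     (\<forall>e\<in>snd \<Gamma>. arc (c e) \<and> path_image (c e) \<subseteq> S \<and>
        {pathstart (c e), pathfinish (c e)} = p ` e \<and>
        path_image (c e) \<inter> p ` fst \<Gamma> = p ` e) \<and>
     (\<forall>e\<in>snd \<Gamma>. \<forall>e'\<in>snd \<Gamma>. e \<noteq> e' \<longrightarrow>
        path_image (c e) \<inter> path_image (c e') = p ` (e \<inter> e')))"

definition genus :: "'a ugraph \<Rightarrow> nat" where
  "genus \<Gamma> = (LEAST g. embeds_in \<Gamma> (sphere_with_handles g))"

end

theory Submission
  imports Defs
begin

text \<open>Two noncentral rotations always commute, a noncentral rotation never commutes with a
  reflection, and every reflection commutes with at most one other reflection. So the commuting
  graph is a complete graph on the noncentral rotations together with a disjoint graph of maximum
  degree at most one. By invariance of dimension, finitely many arcs do not cover any patch of the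
  surface homeomorphic to an open disc; hence a drawing of the complete graph on any surface can be
  extended by the remaining components, and both graphs embed in the same surfaces.\<close>

section \<open>Embedded graphs leave room for an arc\<close>

text \<open>An arc is homeomorphic to an interval, so following \<open>\<phi>\<close> by the inverse
  \<open>h\<close> would inject an open piece of the plane continuously into the line, against
  invariance of dimension.\<close>

lemma arc_not_superset_open_image:
  fixes c :: "real \<Rightarrow> 'b::t2_space" and \<phi> :: "complex \<Rightarrow> 'b"
  assumes c: "arc c" and U: "open U" "U \<noteq> {}"
    and \<phi>: "continuous_on U \<phi>" "inj_on \<phi> U"
  shows "\<not> \<phi> ` U \<subseteq> path_image c"
proof
  assume sub: "\<phi> ` U \<subseteq> path_image c"
  obtain h where h: "homeomorphism {0..1} (path_image c) c h"
    using homeomorphism_arc[OF c] .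
  have "continuous_on U (h \<circ> \<phi>)"
    using \<phi>(1) sub h by (intro continuous_on_compose) (auto simp: homeomorphism_def
        intro: continuous_on_subset)
  moreover have "inj_on (h \<circ> \<phi>) U"
    by (rule comp_inj_on[OF \<phi>(2)], rule inj_on_inverseI[of _ c])
      (use h sub in \<open>auto simp: homeomorphism_def\<close>)
  ultimately have "DIM(complex) \<le> DIM(real)"
    using U by (intro invariance_of_dimension)
  then show False by simp
qed

text \<open>The closed sets are avoided one at a time: the preimage of the complement of
  \<open>K\<close> is open in the current \<open>W\<close> and nonempty. Since \<open>W\<close>
  shrinks along the way, the hypothesis must speak of every open part of \<open>U\<close>.\<close>

lemma open_image_avoids_closed_family:
  fixes \<phi> :: "'a::topological_space \<Rightarrow> 'b::topological_space"
  assumes "finite F" and U: "open U" "U \<noteq> {}" and \<phi>: "continuous_on U \<phi>"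
    and F: "\<And>K. K \<in> F \<Longrightarrow> closed K"
      "\<And>K W. K \<in> F \<Longrightarrow> open W \<Longrightarrow> W \<noteq> {} \<Longrightarrow> W \<subseteq> U \<Longrightarrow> \<not> \<phi> ` W \<subseteq> K"
  obtains W where "open W" "W \<noteq> {}" "W \<subseteq> U" "\<phi> ` W \<inter> \<Union>F = {}"
proof -
  have "\<exists>W. open W \<and> W \<noteq> {} \<and> W \<subseteq> U \<and> \<phi> ` W \<inter> \<Union>F = {}"
    using \<open>finite F\<close> F
  proof (induction F)
    case (insert K F)
    then obtain W where W: "open W" "W \<noteq> {}" "W \<subseteq> U" "\<phi> ` W \<inter> \<Union>F = {}"
      by (metis insert_iff)
    have "open (\<phi> -` (- K) \<inter> W)"
      using W insert.prems(1)[of K] \<phi> continuous_on_open_vimage[of W \<phi>]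
      by (metis continuous_on_subset insertI1 open_Compl)
    moreover have "\<phi> -` (- K) \<inter> W \<noteq> {}"
      using insert.prems(2)[of K W] W by blast
    ultimately show ?case
      using W by (intro exI[of _ "\<phi> -` (- K) \<inter> W"]) auto
  qed (use U in auto)
  then show ?thesis by (elim exE conjE) (rule that)
qed

lemma arc_compose_continuous_inj:
  assumes "arc c" "continuous_on (path_image c) f" "inj_on f (path_image c)"
  shows "arc (f \<circ> c)"
  unfolding arc_def
proof
  show "path (f \<circ> c)" using assms by (intro path_continuous_image arc_imp_path)
  show "inj_on (f \<circ> c) {0..1}"
    using comp_inj_on[OF arc_imp_inj_on[OF assms(1)]] assms(3) by (simp add: path_image_def)
qed

text \<open>All that is asked of a surface: continuity lets closed sets be pulled back to the plane,
  and injectivity makes invariance of dimension applicable.\<close>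

definition has_planar_patch :: "'b::topological_space set \<Rightarrow> bool" where
  "has_planar_patch S \<longleftrightarrow> (\<exists>(\<phi> :: complex \<Rightarrow> 'b) U.
     open U \<and> U \<noteq> {} \<and> continuous_on U \<phi> \<and> inj_on \<phi> U \<and> \<phi> ` U \<subseteq> S)"

text \<open>Points and arcs are closed and contain no image of a nonempty open planar set, so an
  open \<open>W\<close> remains whose image misses the whole drawing. A short segment in
  \<open>W\<close> is then mapped to the required arc.\<close>

lemma planar_patch_arc_avoiding:
  fixes S :: "'b::t2_space set"
  assumes "has_planar_patch S" "finite P" "finite C" "\<And>c. c \<in> C \<Longrightarrow> arc c"
  obtains c where "arc c" "path_image c \<subseteq> S" "path_image c \<inter> (P \<union> \<Union>(path_image ` C)) = {}"
proof -
  obtain \<phi> :: "complex \<Rightarrow> 'b" and U where U: "open U" "U \<noteq> {}" "continuous_on U \<phi>"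
      "inj_on \<phi> U" "\<phi> ` U \<subseteq> S"
    using assms(1) unfolding has_planar_patch_def by blast
  have point: "\<not> \<phi> ` W \<subseteq> {q}" if "open W" "W \<noteq> {}" "W \<subseteq> U" for W q
  proof
    assume "\<phi> ` W \<subseteq> {q}"
    moreover have "inj_on \<phi> W" using U(4) that(3) by (rule inj_on_subset)
    ultimately have "finite W"
      by (metis finite.emptyI finite.insertI finite_imageD finite_subset)
    then show False using that finite_imp_not_open by blast
  qed
  have fam: "closed K \<and> \<not> \<phi> ` W \<subseteq> K"
    if "K \<in> (\<lambda>q. {q}) ` P \<union> path_image ` C" "open W" "W \<noteq> {}" "W \<subseteq> U" for K W
  proof -
    from that(1) consider q where "K = {q}" | c where "c \<in> C" "K = path_image c" by blast
    then show ?thesis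
    proof cases
      case 1
      then show ?thesis using point[OF that(2-4), of q] by simp
    next
      case 2
      have "arc c" using 2 assms(4) by simp
      then show ?thesis
        unfolding 2(2) using closed_arc_image[of c] arc_not_superset_open_image[of c, OF _ that(2,3)
          continuous_on_subset[OF U(3) that(4)] inj_on_subset[OF U(4) that(4)]] by simp
    qed
  qed
  obtain W where W: "open W" "W \<noteq> {}" "W \<subseteq> U"
      "\<phi> ` W \<inter> \<Union>((\<lambda>q. {q}) ` P \<union> path_image ` C) = {}"
  proof (rule open_image_avoids_closed_family[OF _ U(1-3)])
    show "finite ((\<lambda>q. {q}) ` P \<union> path_image ` C)" using assms(2,3) by simp
    show "closed K" if "K \<in> (\<lambda>q. {q}) ` P \<union> path_image ` C" for K
      using fam[OF that U(1,2)] by simp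
    show "\<not> \<phi> ` W \<subseteq> K" if "K \<in> (\<lambda>q. {q}) ` P \<union> path_image ` C"
      "open W" "W \<noteq> {}" "W \<subseteq> U" for K W
      using fam[OF that] by simp
  qed
  obtain w e where w: "e > 0" "ball w e \<subseteq> W"
    using W(1,2) by (meson ex_in_conv openE)
  \<comment> \<open>Half the radius keeps \<open>v\<close> inside the ball and different from the
    centre; by convexity the segment stays in \<open>W\<close>.\<close>
  define v where "v = w + of_real (e / 2)"
  have "v \<noteq> w" "v \<in> ball w e" "w \<in> ball w e"
    using w(1) by (auto simp: v_def dist_norm)
  then have seg: "path_image (linepath w v) \<subseteq> W"
    using w(2) closed_segment_subset[of w "ball w e" v] by auto
  show ?thesis
  proof (rule that[of "\<phi> \<circ> linepath w v"])
    show "arc (\<phi> \<circ> linepath w v)"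
      using \<open>v \<noteq> w\<close> continuous_on_subset[OF U(3)] inj_on_subset[OF U(4)] seg W(3)
      by (intro arc_compose_continuous_inj arc_linepath) blast+
    have "path_image (\<phi> \<circ> linepath w v) \<subseteq> \<phi> ` W"
      using seg unfolding path_image_compose by blast
    then show "path_image (\<phi> \<circ> linepath w v) \<subseteq> S"
      and "path_image (\<phi> \<circ> linepath w v) \<inter> (P \<union> \<Union>(path_image ` C)) = {}"
      using W(3,4) U(5) by blast+
  qed
qed

text \<open>The patch lies on the sphere around the point with horizontal coordinate
  \<open>(g + 1) * \<i>\<close> and height 0. The cylinders have real axis points and radius 1/2, so
  imaginary part above 1/2 puts the patch outside all of them.\<close>

lemma sphere_with_handles_planar_patch: "has_planar_patch (sphere_with_handles g)"
proof -
  let ?s = "\<lambda>w. sqrt ((real g + 1)\<^sup>2 - (cmod w)\<^sup>2)"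
  let ?\<phi> = "\<lambda>w. (Complex (Re w) (?s w), Im w)"
  have "continuous_on (ball 0 (1/2)) ?\<phi>"
    by (intro continuous_intros continuous_on_Pair continuous_on_Complex)
  moreover have "inj_on ?\<phi> (ball 0 (1/2))"
    by (auto simp: inj_on_def complex_eq_iff)
  moreover have "?\<phi> w \<in> sphere_with_handles g" if "w \<in> ball 0 (1/2)" for w
  proof -
    have "(cmod w)\<^sup>2 < (1/2)\<^sup>2"
      using that by (intro power_strict_mono) auto
    moreover have "(real g + 1)\<^sup>2 \<ge> 1" by simp
    \<comment> \<open>Used twice: the radicand is positive, so the square root squares back to it,
      and it exceeds 1/4, so the root exceeds 1/2.\<close>
    ultimately have gap: "(real g + 1)\<^sup>2 - (cmod w)\<^sup>2 > 3/4" by (simp add: power2_eq_square)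
    have "(Re w)\<^sup>2 + (?s w)\<^sup>2 + (Im w)\<^sup>2 = (real g + 1)\<^sup>2"
      using gap cmod_power2[of w] by simp
    then have "norm (?\<phi> w) = real g + 1"
      by (simp add: norm_prod_def cmod_def)
    moreover have "?s w > 1/2"
      using gap by (intro real_less_rsqrt) (simp add: power2_eq_square)
    then have "Complex (Re w) (?s w) \<notin> ball (handle_axis g k) (1/2)" for k
      using abs_Im_le_cmod[of "handle_axis g k - Complex (Re w) (?s w)"]
      by (auto simp: dist_norm handle_axis_def)
    ultimately show ?thesis by (auto simp: sphere_with_handles_def)
  qed
  ultimately show ?thesis
    unfolding has_planar_patch_def
    by (intro exI[of _ ?\<phi>] exI[of _ "ball 0 (1/2)"]) auto
qed

section \<open>Embedding with additional small components\<close>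

lemma embeds_inE:
  assumes "embeds_in (V, E) S"
  obtains p c where "inj_on p V" "p ` V \<subseteq> S"
    and "\<And>e. e \<in> E \<Longrightarrow> arc (c e) \<and> path_image (c e) \<subseteq> S \<and>
        {pathstart (c e), pathfinish (c e)} = p ` e \<and> path_image (c e) \<inter> p ` V = p ` e"
    and "\<And>e e'. e \<in> E \<Longrightarrow> e' \<in> E \<Longrightarrow> e \<noteq> e' \<Longrightarrow>
        path_image (c e) \<inter> path_image (c e') = p ` (e \<inter> e')"
proof -
  from assms obtain p c where pc: "inj_on p V" "p ` V \<subseteq> S"
      "\<forall>e\<in>E. arc (c e) \<and> path_image (c e) \<subseteq> S \<and>
        {pathstart (c e), pathfinish (c e)} = p ` e \<and> path_image (c e) \<inter> p ` V = p ` e"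
      "\<forall>e\<in>E. \<forall>e'\<in>E. e \<noteq> e' \<longrightarrow> path_image (c e) \<inter> path_image (c e') = p ` (e \<inter> e')"
    unfolding embeds_in_def fst_conv snd_conv by (elim exE conjE) (rule that)
  show ?thesis
    by (rule that[OF pc(1,2) bspec[OF pc(3)] mp[OF bspec[OF bspec[OF pc(4)]]]])
qed

text \<open>The drawing is pulled back along \<open>f\<close>. This serves both for passing to a
  subgraph, with \<open>f = id\<close>, and for renaming vertices.\<close>

lemma embeds_in_inj_hom:
  assumes emb: "embeds_in (V', E') S" and f: "inj_on f V" "f ` V \<subseteq> V'"
    and E: "\<And>e. e \<in> E \<Longrightarrow> e \<subseteq> V \<and> f ` e \<in> E'"
  shows "embeds_in (V, E) S"
proof -
  from emb obtain p c where p: "inj_on p V'" "p ` V' \<subseteq> S"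
    and c: "\<And>e. e \<in> E' \<Longrightarrow> arc (c e) \<and> path_image (c e) \<subseteq> S \<and>
        {pathstart (c e), pathfinish (c e)} = p ` e \<and> path_image (c e) \<inter> p ` V' = p ` e"
    and cc: "\<And>e e'. e \<in> E' \<Longrightarrow> e' \<in> E' \<Longrightarrow> e \<noteq> e' \<Longrightarrow>
        path_image (c e) \<inter> path_image (c e') = p ` (e \<inter> e')"
    by (rule embeds_inE) blast
  have "inj_on (p \<circ> f) V" using f p(1) by (auto intro: comp_inj_on inj_on_subset)
  moreover have "(p \<circ> f) ` V \<subseteq> S" using f p by auto
  moreover have "arc ((c \<circ> image f) e) \<and> path_image ((c \<circ> image f) e) \<subseteq> S \<and>
      {pathstart ((c \<circ> image f) e), pathfinish ((c \<circ> image f) e)} = (p \<circ> f) ` e \<and>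
      path_image ((c \<circ> image f) e) \<inter> (p \<circ> f) ` V = (p \<circ> f) ` e" if "e \<in> E" for e
  proof -
    have sub: "p ` f ` e \<subseteq> p ` f ` V" "p ` f ` V \<subseteq> p ` V'"
      using E[OF that] f(2) by (auto intro!: image_mono)
    have "path_image (c (f ` e)) \<inter> p ` f ` V = path_image (c (f ` e)) \<inter> p ` V' \<inter> p ` f ` V"
      unfolding Int_assoc Int_absorb1[OF sub(2)] ..
    also have "\<dots> = p ` f ` e \<inter> p ` f ` V" using c[of "f ` e"] E[OF that] by simp
    also have "\<dots> = p ` f ` e" using sub(1) by (rule Int_absorb2)
    finally have "path_image (c (f ` e)) \<inter> p ` f ` V = p ` f ` e" .
    then show ?thesis using c[of "f ` e"] E[OF that] by (simp add: image_comp)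
  qed
  moreover have "path_image ((c \<circ> image f) e) \<inter> path_image ((c \<circ> image f) e')
      = (p \<circ> f) ` (e \<inter> e')" if "e \<in> E" "e' \<in> E" "e \<noteq> e'" for e e'
  proof -
    \<comment> \<open>Injectivity of \<open>f\<close> keeps distinct edges distinct and lets images
      commute with intersections, so the crossing condition transfers.\<close>
    have "f ` e \<noteq> f ` e'" using inj_on_image_eq_iff[OF f(1)] E that by blast
    moreover have "f ` (e \<inter> e') = f ` e \<inter> f ` e'"
      using inj_on_image_Int[OF f(1)] E that by blast
    then have "(p \<circ> f) ` (e \<inter> e') = p ` (f ` e \<inter> f ` e')" by (simp only: image_comp[symmetric])
    ultimately show ?thesis using cc[of "f ` e" "f ` e'"] E that by (simp add: comp_apply del: image_comp)
  qed
  ultimately show ?thesis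
    unfolding embeds_in_def fst_conv snd_conv
    by (intro exI[of _ "p \<circ> f"] exI[of _ "c \<circ> image f"]) simp
qed

text \<open>One arc disjoint from the old drawing carries the new component. The case
  \<open>u = v\<close> adds an isolated vertex, the case of distinct \<open>u\<close> and
  \<open>v\<close> an isolated edge.\<close>

lemma embeds_in_add_component:
  fixes S :: "'b::t2_space set"
  assumes emb: "embeds_in (V, E) S" and S: "has_planar_patch S"
    and fin: "finite V" "finite E" and E: "\<And>e. e \<in> E \<Longrightarrow> e \<subseteq> V" and uv: "u \<notin> V" "v \<notin> V"
  shows "embeds_in (insert u (insert v V), E \<union> (if u = v then {} else {{u, v}})) S"
proof -
  from emb obtain p c where p: "inj_on p V" "p ` V \<subseteq> S"
    and c: "\<And>e. e \<in> E \<Longrightarrow> arc (c e) \<and> path_image (c e) \<subseteq> S \<and>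
        {pathstart (c e), pathfinish (c e)} = p ` e \<and> path_image (c e) \<inter> p ` V = p ` e"
    and cc: "\<And>e e'. e \<in> E \<Longrightarrow> e' \<in> E \<Longrightarrow> e \<noteq> e' \<Longrightarrow>
        path_image (c e) \<inter> path_image (c e') = p ` (e \<inter> e')"
    by (rule embeds_inE) blast
  obtain a where a: "arc a" "path_image a \<subseteq> S"
    and avoid: "path_image a \<inter> (p ` V \<union> \<Union>(path_image ` c ` E)) = {}"
    using planar_patch_arc_avoiding[OF S, of "p ` V" "c ` E"] fin c by blast
  \<comment> \<open>If \<open>u = v\<close>, the later update prevails and the vertex sits at
    \<open>pathfinish a\<close>.\<close>
  define q where "q = p(u := pathstart a, v := pathfinish a)"
  \<comment> \<open>The update leaves old edges alone, because they lie in \<open>V\<close> while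
    \<open>{u, v}\<close> does not.\<close>
  define d where "d = c({u, v} := a)"
  let ?V = "insert u (insert v V)" and ?E = "E \<union> (if u = v then {} else {{u, v}})"
  have ends: "pathstart a \<in> path_image a" "pathfinish a \<in> path_image a"
      "pathstart a \<noteq> pathfinish a"
    using arc_distinct_ends[OF a(1)] by auto
  have avoidV: "path_image a \<inter> p ` V = {}" using avoid by blast
  have avoidE: "path_image a \<inter> path_image (c e) = {}" if "e \<in> E" for e
    using avoid that by blast
  have qV: "q ` A = p ` A" if "A \<subseteq> V" for A
    unfolding q_def using that uv by (intro image_cong) auto
  have quv: "q ` {u, v} \<subseteq> path_image a" unfolding q_def using ends by auto
  have q_ends: "q ` {u, v} = {pathstart a, pathfinish a}" if "u \<noteq> v"
    using that by (auto simp: q_def)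
  have imV: "q ` ?V = q ` {u, v} \<union> p ` V" using qV[of V] by auto
  have d_old: "d e = c e" if "e \<in> E" for e
    using E[OF that] uv by (auto simp: d_def)
  have d_new: "d {u, v} = a" by (simp add: d_def)
  have inj: "inj_on q ?V"
  proof -
    have "inj_on q V" using p(1) uv by (auto simp: inj_on_def q_def)
    moreover have "q u \<notin> q ` V" "q v \<notin> q ` V" using quv avoidV qV[of V] by auto
    moreover have "q u \<noteq> q v" if "u \<noteq> v" using ends that by (simp add: q_def)
    ultimately show ?thesis using uv
      by (cases "u = v") (auto simp: insert_Diff_if)
  qed
  have "q ` ?V \<subseteq> S" unfolding imV using quv a(2) p(2) by blast
  moreover have "arc (d e) \<and> path_image (d e) \<subseteq> S \<and>
      {pathstart (d e), pathfinish (d e)} = q ` e \<and> path_image (d e) \<inter> q ` ?V = q ` e"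
    if "e \<in> ?E" for e
  proof -
    from that consider "e \<in> E" | "u \<noteq> v" "e = {u, v}" by (auto split: if_splits)
    then show ?thesis
    proof cases
      case 1
      have "path_image (c e) \<inter> q ` ?V = path_image (c e) \<inter> p ` V"
        unfolding imV using quv avoidE[OF 1] by blast
      then show ?thesis using c[OF 1] by (simp only: d_old[OF 1] qV[OF E[OF 1]] simp_thms)
    next
      case 2
      have "path_image a \<inter> q ` ?V = q ` {u, v}" unfolding imV using quv avoidV by blast
      then show ?thesis using a q_ends[OF 2(1)] by (simp only: 2(2) d_new simp_thms)
    qed
  qed
  moreover have "path_image (d e) \<inter> path_image (d e') = q ` (e \<inter> e')"
    if ee': "e \<in> ?E" "e' \<in> ?E" "e \<noteq> e'" for e e'
  proof -
    have mixed: "path_image (c f) \<inter> path_image a = q ` (f \<inter> {u, v})" if "f \<in> E" for f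
    proof -
      have "f \<inter> {u, v} = {}" using E[OF that] uv by blast
      then show ?thesis using avoidE[OF that] by (simp add: Int_commute)
    qed
    from ee' consider "e \<in> E" "e' \<in> E" | "e \<in> E" "e' = {u, v}" | "e = {u, v}" "e' \<in> E"
      by (auto split: if_splits)
    then show ?thesis
    proof cases
      case 1
      have "e \<inter> e' \<subseteq> V" using E[OF 1(1)] by blast
      from qV[OF this] show ?thesis using cc[OF 1 ee'(3)] by (simp only: d_old[OF 1(1)] d_old[OF 1(2)])
    next
      case 2
      then show ?thesis using mixed[of e] by (simp only: d_old d_new)
    next
      case 3
      then show ?thesis using mixed[of e'] by (simp only: d_old d_new Int_commute)
    qed
  qed
  ultimately show ?thesis
    unfolding embeds_in_def fst_conv snd_conv using inj by (intro exI[of _ q] exI[of _ d]) simp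
qed

text \<open>Two inductions: first the edges of \<open>M\<close> are added together with their ends,
  then the vertices of \<open>W\<close> that \<open>M\<close> leaves uncovered.\<close>

lemma embeds_in_add_matching:
  fixes S :: "'b::t2_space set"
  assumes emb: "embeds_in (V, E) S" and S: "has_planar_patch S"
    and fin: "finite V" "finite E" and E: "\<And>e. e \<in> E \<Longrightarrow> e \<subseteq> V"
    and W: "finite W" "V \<inter> W = {}" and M: "\<And>e. e \<in> M \<Longrightarrow> e \<subseteq> W \<and> card e = 2"
    and disj: "pairwise disjnt M"
  shows "embeds_in (V \<union> W, E \<union> M) S"
proof -
  have "M \<subseteq> Pow W" using M by blast
  then have "finite M" by (rule finite_subset) (simp add: W(1))
  then have matched: "embeds_in (V \<union> \<Union>M, E \<union> M) S" using M disj
  proof (induction M)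
    case (insert e M)
    have "card e = 2" using insert.prems(1)[of e] by simp
    then obtain u v where e: "e = {u, v}" "u \<noteq> v" unfolding card_2_iff by blast
    have sub: "f \<subseteq> W" if "f \<in> insert e M" for f using insert.prems(1) that by blast
    have "\<Union>M \<subseteq> W" using sub by blast
    then have finM: "finite (V \<union> \<Union>M)"
      using fin(1) finite_subset[OF _ W(1)] by (simp only: finite_Un)
    have "embeds_in (V \<union> \<Union>M, E \<union> M) S"
      using insert by (simp add: pairwise_insert)
    \<comment> \<open>Pairwise disjointness is what makes both ends of the next edge new.\<close>
    moreover have "x \<notin> V \<union> \<Union>M" if "x \<in> e" for x
      using sub[of e] that W(2) insert.prems(2) insert.hyps(2)
      by (auto simp: pairwise_insert disjnt_def)
    ultimately have "embeds_in (insert u (insert v (V \<union> \<Union>M)),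
        (E \<union> M) \<union> (if u = v then {} else {{u, v}})) S"
      using finM insert.hyps(1) fin(2) E e by (intro embeds_in_add_component[OF _ S]) auto
    then show ?case using e by (simp add: insert_commute Un_commute)
  qed (use emb in simp)
  \<comment> \<open>Uncovered vertices are added as degenerate components with
    \<open>u = v = w\<close>.\<close>
  have "embeds_in ((V \<union> \<Union>M) \<union> B, E \<union> M) S" if "finite B" "B \<subseteq> W - \<Union>M" for B
    using that
  proof (induction B)
    case (insert w B)
    have "\<Union>M \<subseteq> W" using M by blast
    then have "finite (V \<union> \<Union>M \<union> B)"
      using fin(1) insert.hyps(1) finite_subset[OF _ W(1)] by (simp only: finite_Un)
    then have "embeds_in (insert w (insert w (V \<union> \<Union>M \<union> B)),
        (E \<union> M) \<union> (if w = w then {} else {{w, w}})) S"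
      using insert \<open>finite M\<close> fin(2) E W(2)
      by (intro embeds_in_add_component[OF _ S]) auto
    then show ?case by simp
  qed (use matched in simp)
  from this[of "W - \<Union>M"] have "embeds_in ((V \<union> \<Union>M) \<union> (W - \<Union>M), E \<union> M) S"
    using W(1) by simp
  moreover have "(V \<union> \<Union>M) \<union> (W - \<Union>M) = V \<union> W" using M by blast
  ultimately show ?thesis by simp
qed

section \<open>Complete graphs on arbitrary vertex sets\<close>

definition complete_edges :: "'a set \<Rightarrow> 'a set set" where
  "complete_edges A = {{x, y} | x y. x \<in> A \<and> y \<in> A \<and> x \<noteq> y}"

lemma embeds_in_complete_mono:
  assumes "embeds_in (B, complete_edges B) S" "inj_on f A" "f ` A \<subseteq> B"
  shows "embeds_in (A, complete_edges A) S"
  using assms(1)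
proof (rule embeds_in_inj_hom[OF _ assms(2,3)])
  fix e assume "e \<in> complete_edges A"
  then obtain x y where "e = {x, y}" "x \<in> A" "y \<in> A" "x \<noteq> y"
    by (auto simp: complete_edges_def)
  moreover from this have "f x \<noteq> f y" using assms(2) by (auto dest: inj_onD)
  ultimately show "e \<subseteq> A \<and> f ` e \<in> complete_edges B"
    using assms(3) by (auto simp: complete_edges_def)
qed

text \<open>Every injection maps edges of a complete graph to edges, so a bijection with
  \<open>{..<card A}\<close> and its inverse carry drawings both ways.\<close>

lemma embeds_in_complete_graph_iff:
  assumes "finite A"
  shows "embeds_in (complete_graph (card A)) S \<longleftrightarrow> embeds_in (A, complete_edges A) S"
proof -
  have K: "complete_graph (card A) = ({..<card A}, complete_edges {..<card A})"
    by (auto simp: complete_graph_def complete_edges_def)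
  obtain f where f: "bij_betw f A {..<card A}"
    using finite_same_card_bij[OF assms finite_lessThan, of "card A"] by auto
  then have h: "bij_betw (inv_into A f) {..<card A} A" by (rule bij_betw_inv_into)
  show ?thesis
    unfolding K
    using embeds_in_complete_mono[OF _ bij_betw_imp_inj_on[OF f] equalityD1[OF bij_betw_imp_surj_on[OF f]]]
      embeds_in_complete_mono[OF _ bij_betw_imp_inj_on[OF h] equalityD1[OF bij_betw_imp_surj_on[OF h]]]
    by (rule iffI)
qed

section \<open>The word problem in the dihedral group\<close>

text \<open>A word represents \<open>y\<^sup>k x\<^sup>b\<close>, where \<open>k\<close> is its rotation and \<open>b\<close> tells whether it is a
  reflection.\<close>

fun rotation :: "dihedral_gen word \<Rightarrow> int" where
  "rotation [] = 0"
| "rotation ((X, t) # w) = - rotation w"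
| "rotation ((Y, t) # w) = (if t then 1 else -1) + rotation w"

fun reflection :: "dihedral_gen word \<Rightarrow> bool" where
  "reflection [] = False"
| "reflection ((X, t) # w) = (\<not> reflection w)"
| "reflection ((Y, t) # w) = reflection w"

lemma reflection_append: "reflection (u @ v) \<longleftrightarrow> reflection u \<noteq> reflection v"
  by (induction u rule: reflection.induct) auto

text \<open>The semidirect product law: moving a rotation to the left past a reflection inverts
  it.\<close>

lemma rotation_append:
  "rotation (u @ v) = rotation u + (if reflection u then - rotation v else rotation v)"
  by (induction u rule: rotation.induct) auto

lemma rotation_replicate_Y: "rotation (replicate n (Y, t)) = (if t then int n else - int n)"
  by (induction n) auto

lemma reflection_replicate_Y: "\<not> reflection (replicate n (Y, t))"
  by (induction n) auto

lemma concat_replicate_singleton: "concat (replicate n [a]) = replicate n a"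
  by (induction n) auto

definition dihedral_relations :: "nat \<Rightarrow> (dihedral_gen word \<times> dihedral_gen word) set" where
  "dihedral_relations n =
    {(concat (replicate n (gen Y)), []), (gen X @ gen X, []),
     (gen X @ gen Y @ gen_inv X, gen_inv Y)}"

lemma dihedral_group_eq: "dihedral_group n = presented_group (dihedral_relations n)"
  by (simp add: dihedral_group_def dihedral_relations_def)

text \<open>Only the relation for the \<open>n\<close>-th power of \<open>Y\<close> changes the
  integer \<open>rotation\<close>, and it does so by a multiple of \<open>n\<close>. This direction
  keeps the presented group from collapsing.\<close>

lemma rotation_reflection_invariant:
  assumes "word_eq (dihedral_relations n) u v"
  shows "int n dvd rotation u - rotation v \<and> reflection u = reflection v"
  using assms
proof (induction rule: word_eq.induct)
  case (sym u v)
  then show ?case by (metis dvd_diff_commute)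
next
  case (trans u v w)
  then show ?case using dvd_add[of "int n" "rotation u - rotation v" "rotation v - rotation w"]
    by auto
next
  case (cancel u g b v)
  then show ?case by (cases g) (auto simp: rotation_append reflection_append)
next
  case (relation r s u v)
  then show ?case
    by (auto simp: dihedral_relations_def concat_replicate_singleton rotation_append
        reflection_append rotation_replicate_Y reflection_replicate_Y)
qed auto

abbreviation dihedral_elt :: "nat \<Rightarrow> dihedral_gen word \<Rightarrow> dihedral_gen word set" where
  "dihedral_elt n \<equiv> word_class (dihedral_relations n)"

text \<open>Conjugation by \<open>x\<close> is an endomorphism and hence respects integer
  powers.\<close>

lemma (in group) conj_int_pow:
  fixes k :: int
  assumes "x \<in> carrier G" "y \<in> carrier G" "x \<otimes> y \<otimes> inv x = inv y"
  shows "x \<otimes> y [^] k = y [^] (- k) \<otimes> x"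
proof -
  have "(\<lambda>z. x \<otimes> z \<otimes> inv x) \<in> hom G G"
    using assms(1) by (auto simp: hom_def m_assoc inv_solve_left)
  from hom_int_pow[OF this assms(2) is_group is_group, of k]
  have "x \<otimes> y [^] k \<otimes> inv x = (inv y) [^] k" using assms(3) by simp
  also have "\<dots> = y [^] (- k)" using assms by (simp add: int_pow_inv int_pow_neg)
  finally show ?thesis using assms by (metis int_pow_closed inv_solve_right' m_closed)
qed

text \<open>The converse direction to invariance: the relations suffice to bring each word into the
  form \<open>y\<close> to a power times \<open>x\<close> or 1. Induction over the letters of the
  word.\<close>

lemma dihedral_elt_normal_form:
  fixes n :: nat and w :: "dihedral_gen word"
  defines "G \<equiv> dihedral_group n"
  defines "x \<equiv> dihedral_elt n (gen X)" and "y \<equiv> dihedral_elt n (gen Y)"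
  shows "dihedral_elt n w = y [^]\<^bsub>G\<^esub> rotation w \<otimes>\<^bsub>G\<^esub> (if reflection w then x else \<one>\<^bsub>G\<^esub>)"
    and "y [^]\<^bsub>G\<^esub> int n = \<one>\<^bsub>G\<^esub>"
proof -
  interpret G: group G
    unfolding G_def dihedral_group_eq by (rule group_presented_group)
  let ?R = "dihedral_relations n"
  have mult: "dihedral_elt n u \<otimes>\<^bsub>G\<^esub> dihedral_elt n v = dihedral_elt n (u @ v)" for u v
    unfolding G_def dihedral_group_eq by (rule mult_presented_group)
  have one: "\<one>\<^bsub>G\<^esub> = dihedral_elt n []"
    unfolding G_def dihedral_group_eq by (rule one_presented_group)
  have car: "dihedral_elt n u \<in> carrier G" for u
    unfolding G_def dihedral_group_eq carrier_presented_group by simp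
  have xy: "x \<in> carrier G" "y \<in> carrier G" by (simp_all only: x_def y_def car)
  have rel: "dihedral_elt n r = dihedral_elt n s" if "(r, s) \<in> ?R" for r s
    using word_eq.relation[OF that, of "[]" "[]"] by (intro word_class_eqI) simp
  have inverse: "dihedral_elt n (gen_inv g) = inv\<^bsub>G\<^esub> dihedral_elt n (gen g)" for g
  proof (rule G.inv_equality[symmetric])
    show "dihedral_elt n (gen_inv g) \<otimes>\<^bsub>G\<^esub> dihedral_elt n (gen g) = \<one>\<^bsub>G\<^esub>"
      unfolding mult one using word_eq.cancel[of ?R "[]" g False "[]"]
      by (intro word_class_eqI) simp
  qed (rule car)+
  have xx: "x \<otimes>\<^bsub>G\<^esub> x = \<one>\<^bsub>G\<^esub>"
    unfolding x_def mult one by (rule rel) (simp add: dihedral_relations_def)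
  have "x \<otimes>\<^bsub>G\<^esub> y \<otimes>\<^bsub>G\<^esub> inv\<^bsub>G\<^esub> x = inv\<^bsub>G\<^esub> y"
    unfolding x_def y_def inverse[symmetric] mult
    by (rule rel) (simp add: dihedral_relations_def)
  note conj = G.conj_int_pow[OF xy this]
  have invx: "inv\<^bsub>G\<^esub> x = x" using xx xy by (metis G.inv_equality)
  show "dihedral_elt n w = y [^]\<^bsub>G\<^esub> rotation w \<otimes>\<^bsub>G\<^esub> (if reflection w then x else \<one>\<^bsub>G\<^esub>)"
  proof (induction w rule: rotation.induct)
    case 1
    have "\<one>\<^bsub>G\<^esub> \<otimes>\<^bsub>G\<^esub> \<one>\<^bsub>G\<^esub> = \<one>\<^bsub>G\<^esub>" by simp
    then show ?case by (simp flip: one)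
  next
    case (2 t w)
    \<comment> \<open>As \<open>x\<close> is its own inverse, the sign of the letter does not
      matter.\<close>
    have "dihedral_elt n [(X, t)] = x" using invx inverse[of X] by (cases t) (auto simp: x_def)
    then have "dihedral_elt n ((X, t) # w) = x \<otimes>\<^bsub>G\<^esub> dihedral_elt n w"
      using mult[of "[(X, t)]" w] by simp
    also have "\<dots> = y [^]\<^bsub>G\<^esub> (- rotation w) \<otimes>\<^bsub>G\<^esub> (x \<otimes>\<^bsub>G\<^esub> (if reflection w then x else \<one>\<^bsub>G\<^esub>))"
      unfolding 2 using xy conj[of "rotation w"]
      by (simp add: G.m_assoc[symmetric])
    finally show ?case using xx xy by simp
  next
    case (3 t w)
    have "dihedral_elt n [(Y, t)] = y [^]\<^bsub>G\<^esub> (if t then 1 else - 1 :: int)"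
      using inverse[of Y] xy by (cases t) (auto simp: y_def G.int_pow_neg car)
    then have "dihedral_elt n ((Y, t) # w)
        = y [^]\<^bsub>G\<^esub> (if t then 1 else - 1 :: int) \<otimes>\<^bsub>G\<^esub> dihedral_elt n w"
      using mult[of "[(Y, t)]" w] by simp
    then show ?case unfolding 3 using xy by (simp add: G.m_assoc[symmetric] G.int_pow_mult)
  qed
  \<comment> \<open>Powers are written as words so that, for \<open>m = n\<close>, the first
    defining relation applies.\<close>
  have "y [^]\<^bsub>G\<^esub> m = dihedral_elt n (replicate m (Y, True))" for m :: nat
    by (induction m) (auto simp: one y_def mult replicate_append_same)
  then have "y [^]\<^bsub>G\<^esub> n = \<one>\<^bsub>G\<^esub>"
    using rel[of "replicate n (Y, True)" "[]"]
    by (simp add: one dihedral_relations_def concat_replicate_singleton)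
  then show "y [^]\<^bsub>G\<^esub> int n = \<one>\<^bsub>G\<^esub>" by (simp add: int_pow_int)
qed

text \<open>Solves the word problem: invariance gives one direction, the normal form the other.
  Questions about elements now become divisibility questions.\<close>

lemma dihedral_elt_eq_iff:
  "dihedral_elt n u = dihedral_elt n v \<longleftrightarrow>
    int n dvd rotation u - rotation v \<and> reflection u = reflection v"
proof
  assume "dihedral_elt n u = dihedral_elt n v"
  then have "word_eq (dihedral_relations n) u v" using word_eq.refl by blast
  then show "int n dvd rotation u - rotation v \<and> reflection u = reflection v"
    by (rule rotation_reflection_invariant)
next
  assume *: "int n dvd rotation u - rotation v \<and> reflection u = reflection v"
  let ?G = "dihedral_group n" and ?y = "dihedral_elt n (gen Y)"
  interpret G: group ?G
    unfolding dihedral_group_eq by (rule group_presented_group)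
  have y: "?y \<in> carrier ?G"
    unfolding dihedral_group_eq carrier_presented_group by simp
  from * obtain m where m: "rotation u = int n * m + rotation v"
    by (metis add.commute diff_add_cancel dvdE)
  have "?y [^]\<^bsub>?G\<^esub> rotation u = ?y [^]\<^bsub>?G\<^esub> rotation v"
    unfolding m using y dihedral_elt_normal_form(2)[of n]
    by (simp add: G.int_pow_mult G.int_pow_pow[symmetric])
  then show "dihedral_elt n u = dihedral_elt n v"
    using * dihedral_elt_normal_form(1)[of n u] dihedral_elt_normal_form(1)[of n v] by simp
qed

text \<open>Both products have the same \<open>reflection\<close>, so only the difference of their
  rotations matters. The conditionals merge the four combinations of rotations and reflections into
  one formula.\<close>

lemma dihedral_elt_commute_iff:
  "dihedral_elt n u \<otimes>\<^bsub>dihedral_group n\<^esub> dihedral_elt n v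
      = dihedral_elt n v \<otimes>\<^bsub>dihedral_group n\<^esub> dihedral_elt n u \<longleftrightarrow>
    int n dvd 2 * ((if reflection v then rotation u else 0) - (if reflection u then rotation v else 0))"
proof -
  have "rotation (u @ v) - rotation (v @ u) =
      2 * ((if reflection v then rotation u else 0) - (if reflection u then rotation v else 0))"
    by (simp add: rotation_append)
  moreover have "reflection (u @ v) = reflection (v @ u)" by (auto simp: reflection_append)
  ultimately show ?thesis
    unfolding dihedral_group_eq mult_presented_group dihedral_elt_eq_iff by (simp only: simp_thms)
qed

lemma word_with_rotation_reflection:
  obtains w where "rotation w = k" "reflection w = b"
proof (rule that)
  let ?w = "replicate (nat \<bar>k\<bar>) (Y, 0 \<le> k) @ (if b then gen X else [])"
  show "rotation ?w = k" "reflection ?w = b"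
    by (auto simp: rotation_append reflection_append rotation_replicate_Y reflection_replicate_Y)
qed

section \<open>The commuting graph of the dihedral group\<close>

lemma carrier_dihedral_group: "carrier (dihedral_group n) = range (dihedral_elt n)"
  unfolding dihedral_group_eq carrier_presented_group ..

text \<open>An element is determined by its rotation modulo \<open>n\<close> and its reflection bit,
  and there are finitely many such pairs.\<close>

lemma finite_carrier_dihedral_group:
  assumes "n > 0"
  shows "finite (carrier (dihedral_group n))"
proof -
  let ?inv = "\<lambda>w. (rotation w mod int n, reflection w)"
  have "carrier (dihedral_group n) \<subseteq>
      (\<lambda>q. dihedral_elt n (SOME w. ?inv w = q)) ` ({0..<int n} \<times> UNIV)"
  proof
    fix A assume "A \<in> carrier (dihedral_group n)"
    then obtain w where A: "A = dihedral_elt n w" unfolding carrier_dihedral_group by blast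
    define v where "v = (SOME v. ?inv v = ?inv w)"
    have "?inv v = ?inv w" unfolding v_def by (rule someI[of _ w]) simp
    then have "A = dihedral_elt n v"
      unfolding A dihedral_elt_eq_iff by (simp flip: mod_eq_dvd_iff)
    moreover have "?inv w \<in> {0..<int n} \<times> UNIV" using assms by simp
    ultimately show "A \<in> (\<lambda>q. dihedral_elt n (SOME w. ?inv w = q)) ` ({0..<int n} \<times> UNIV)"
      unfolding v_def by (rule image_eqI)
  qed
  then show ?thesis by (rule finite_subset) simp
qed

lemma dihedral_elt_central_iff:
  assumes "n \<ge> 3"
  shows "dihedral_elt n w \<in> group_center (dihedral_group n) \<longleftrightarrow>
    \<not> reflection w \<and> int n dvd 2 * rotation w"
proof -
  \<comment> \<open>It is enough to test centrality against \<open>r\<close>, standing for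
    \<open>y\<close>, and \<open>s\<close>, standing for \<open>x\<close>.\<close>
  obtain r where r: "rotation r = 1" "\<not> reflection r"
    using word_with_rotation_reflection[of 1 False] by auto
  obtain s where s: "rotation s = 0" "reflection s"
    using word_with_rotation_reflection[of 0 True] by auto
  have "\<not> int n dvd 2" using assms by (auto dest: zdvd_imp_le)
  have "dihedral_elt n w \<in> group_center (dihedral_group n) \<longleftrightarrow> (\<forall>v. int n dvd
      2 * ((if reflection v then rotation w else 0) - (if reflection w then rotation v else 0)))"
    unfolding group_center_def carrier_dihedral_group dihedral_elt_commute_iff[symmetric] by blast
  also have "\<dots> \<longleftrightarrow> \<not> reflection w \<and> int n dvd 2 * rotation w"
  proof
    assume *: "\<forall>v. int n dvd
      2 * ((if reflection v then rotation w else 0) - (if reflection w then rotation v else 0))"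
    \<comment> \<open>If \<open>w\<close> were a reflection, commuting with \<open>r\<close> would
      make \<open>n\<close> divide 2, which \<open>n \<ge> 3\<close> excludes.\<close>
    have "\<not> reflection w" using spec[OF *, of r] r \<open>\<not> int n dvd 2\<close> by auto
    then show "\<not> reflection w \<and> int n dvd 2 * rotation w" using spec[OF *, of s] s by simp
  qed auto
  finally show ?thesis .
qed

definition noncentral_rotations :: "nat \<Rightarrow> dihedral_gen word set set" where
  "noncentral_rotations n = {dihedral_elt n w | w. \<not> reflection w \<and> \<not> int n dvd 2 * rotation w}"

definition reflections :: "nat \<Rightarrow> dihedral_gen word set set" where
  "reflections n = {dihedral_elt n w | w. reflection w}"

definition reflection_edges :: "nat \<Rightarrow> dihedral_gen word set set set" where
  "reflection_edges n = {{A, B} | A B. A \<in> reflections n \<and> B \<in> reflections n \<and> A \<noteq> B \<and>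
    A \<otimes>\<^bsub>dihedral_group n\<^esub> B = B \<otimes>\<^bsub>dihedral_group n\<^esub> A}"

lemma noncentral_dihedral_group:
  assumes "n \<ge> 3"
  shows "carrier (dihedral_group n) - group_center (dihedral_group n)
    = noncentral_rotations n \<union> reflections n"
proof (rule Set.set_eqI)
  fix A
  have "A \<in> carrier (dihedral_group n) - group_center (dihedral_group n) \<longleftrightarrow>
      (\<exists>w. A = dihedral_elt n w \<and> \<not> (\<not> reflection w \<and> int n dvd 2 * rotation w))"
    unfolding carrier_dihedral_group dihedral_elt_central_iff[OF assms, symmetric] by blast
  also have "\<dots> \<longleftrightarrow> A \<in> noncentral_rotations n \<union> reflections n"
    unfolding noncentral_rotations_def reflections_def Un_iff mem_Collect_eq by blast
  finally show "A \<in> carrier (dihedral_group n) - group_center (dihedral_group n) \<longleftrightarrow>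
      A \<in> noncentral_rotations n \<union> reflections n" .
qed

lemma rotations_commute:
  assumes "A \<in> noncentral_rotations n" "B \<in> noncentral_rotations n"
  shows "A \<otimes>\<^bsub>dihedral_group n\<^esub> B = B \<otimes>\<^bsub>dihedral_group n\<^esub> A"
proof -
  obtain u v where "A = dihedral_elt n u" "B = dihedral_elt n v" "\<not> reflection u" "\<not> reflection v"
    using assms unfolding noncentral_rotations_def by blast
  then show ?thesis by (simp only: dihedral_elt_commute_iff if_False diff_self mult_zero_right dvd_0_right)
qed

text \<open>For a rotation \<open>u\<close> and a reflection \<open>v\<close> the criterion reads
  \<open>int n dvd 2 * rotation u\<close>, which is what noncentrality denies.\<close>

lemma rotation_reflection_not_commute:
  assumes "A \<in> noncentral_rotations n" "B \<in> reflections n"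
  shows "A \<otimes>\<^bsub>dihedral_group n\<^esub> B \<noteq> B \<otimes>\<^bsub>dihedral_group n\<^esub> A"
proof -
  obtain u v where "A = dihedral_elt n u" "\<not> reflection u" "\<not> int n dvd 2 * rotation u"
    and "B = dihedral_elt n v" "reflection v"
    using assms unfolding noncentral_rotations_def reflections_def by blast
  then show ?thesis by (simp only: dihedral_elt_commute_iff if_True if_False diff_zero not_False_eq_True)
qed

lemma commuting_graph_dihedral_group:
  assumes "n \<ge> 3"
  shows "commuting_graph (dihedral_group n) = (noncentral_rotations n \<union> reflections n,
    complete_edges (noncentral_rotations n) \<union> reflection_edges n)"
proof -
  let ?G = "dihedral_group n" and ?R = "noncentral_rotations n" and ?S = "reflections n"
  have edge: "x \<in> ?R \<union> ?S \<and> y \<in> ?R \<union> ?S \<and> x \<noteq> y \<and> x \<otimes>\<^bsub>?G\<^esub> y = y \<otimes>\<^bsub>?G\<^esub> x \<longleftrightarrow>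
      (x \<in> ?R \<and> y \<in> ?R \<and> x \<noteq> y) \<or>
      (x \<in> ?S \<and> y \<in> ?S \<and> x \<noteq> y \<and> x \<otimes>\<^bsub>?G\<^esub> y = y \<otimes>\<^bsub>?G\<^esub> x)" for x y
    unfolding Un_iff using rotations_commute[of x n y] rotation_reflection_not_commute[of x n y]
      rotation_reflection_not_commute[of y n x] by argo
  have "{{x, y} | x y. x \<in> ?R \<union> ?S \<and> y \<in> ?R \<union> ?S \<and> x \<noteq> y \<and> x \<otimes>\<^bsub>?G\<^esub> y = y \<otimes>\<^bsub>?G\<^esub> x}
      = complete_edges ?R \<union> reflection_edges n"
    unfolding complete_edges_def reflection_edges_def edge by blast
  then show ?thesis
    unfolding commuting_graph_def noncentral_dihedral_group[OF assms] by simp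
qed

text \<open>For distinct commuting reflections, twice the difference of the rotations is an odd
  multiple of \<open>n\<close>. Subtracting two odd multiples gives an even one, so \<open>n\<close>
  divides the difference for \<open>B\<close> and \<open>C\<close>. No case split on the parity of
  \<open>n\<close> arises.\<close>

lemma commuting_reflection_unique:
  assumes "A \<in> reflections n" "B \<in> reflections n" "C \<in> reflections n" "B \<noteq> A" "C \<noteq> A"
    and "A \<otimes>\<^bsub>dihedral_group n\<^esub> B = B \<otimes>\<^bsub>dihedral_group n\<^esub> A"
    and "A \<otimes>\<^bsub>dihedral_group n\<^esub> C = C \<otimes>\<^bsub>dihedral_group n\<^esub> A"
  shows "B = C"
proof -
  obtain a b c where elt: "A = dihedral_elt n a" "B = dihedral_elt n b" "C = dihedral_elt n c"
    and refl: "reflection a" "reflection b" "reflection c"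
    using assms(1-3) unfolding reflections_def by blast
  have "int n dvd 2 * (rotation a - rotation b)" "int n dvd 2 * (rotation a - rotation c)"
    using assms(6,7) unfolding elt dihedral_elt_commute_iff by (simp_all add: refl)
  then obtain s t where st: "2 * (rotation a - rotation b) = int n * s"
      "2 * (rotation a - rotation c) = int n * t" by (metis dvdE)
  have nondvd: "\<not> int n dvd rotation a - rotation b" "\<not> int n dvd rotation a - rotation c"
    using assms(4,5) unfolding elt dihedral_elt_eq_iff by (auto simp: refl dvd_diff_commute)
  have "odd q" if "2 * d = int n * q" "\<not> int n dvd d" for d q :: int
  proof
    assume "even q"
    then obtain k where "q = 2 * k" by (rule evenE)
    then have "d = int n * k" using that(1) by simp
    then show False using that(2) by simp
  qed
  then have "odd s" "odd t" using st nondvd by blast+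
  then have "even (t - s)" by simp
  then obtain m where "t - s = 2 * m" by (rule evenE)
  moreover have "2 * (rotation b - rotation c) = int n * (t - s)"
    using st by (simp add: right_diff_distrib)
  ultimately have "2 * (rotation b - rotation c) = int n * (2 * m)" by simp
  then have "rotation b - rotation c = int n * m" by simp
  then show ?thesis unfolding elt dihedral_elt_eq_iff by (simp add: refl)
qed

lemma reflection_edges_matching: "pairwise disjnt (reflection_edges n)"
proof (rule pairwiseI)
  fix e f assume e: "e \<in> reflection_edges n" and f: "f \<in> reflection_edges n" and "e \<noteq> f"
  \<comment> \<open>Turns the unordered pair around so that the shared vertex comes first;
    uniqueness of its partner then gives \<open>e = f\<close>.\<close>
  have through: "\<exists>B. e = {A, B} \<and> A \<in> reflections n \<and> B \<in> reflections n \<and> B \<noteq> A \<and>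
      A \<otimes>\<^bsub>dihedral_group n\<^esub> B = B \<otimes>\<^bsub>dihedral_group n\<^esub> A"
    if "e \<in> reflection_edges n" "A \<in> e" for e A
    using that unfolding reflection_edges_def by (auto simp: doubleton_eq_iff)
  show "disjnt e f"
    unfolding disjnt_iff
  proof (intro allI notI, elim conjE)
    fix A assume "A \<in> e" "A \<in> f"
    then show False
      using through[OF e] through[OF f] commuting_reflection_unique[of A n] \<open>e \<noteq> f\<close> by metis
  qed
qed

text \<open>Rotations correspond to residues \<open>k\<close> modulo \<open>n\<close>. The central
  ones are \<open>k = 0\<close> and, for even \<open>n\<close>, also
  \<open>k = n div 2\<close>.\<close>

lemma card_noncentral_rotations:
  assumes "n \<ge> 3"
  shows "card (noncentral_rotations n) = (if even n then n - 2 else n - 1)"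
proof -
  let ?K = "{k \<in> {0..<int n}. \<not> int n dvd 2 * k}"
  define w where "w k = (SOME w. rotation w = k \<and> \<not> reflection w)" for k
  have w: "rotation (w k) = k" "\<not> reflection (w k)" for k
  proof -
    have "\<exists>v. rotation v = k \<and> \<not> reflection v"
      using word_with_rotation_reflection[of k False] by metis
    then have "rotation (w k) = k \<and> \<not> reflection (w k)" unfolding w_def by (rule someI_ex)
    then show "rotation (w k) = k" "\<not> reflection (w k)" by auto
  qed
  have "bij_betw (\<lambda>k. dihedral_elt n (w k)) ?K (noncentral_rotations n)"
    unfolding bij_betw_def
  proof
    show "inj_on (\<lambda>k. dihedral_elt n (w k)) ?K"
    proof (rule inj_onI)
      fix k l assume "k \<in> ?K" "l \<in> ?K" "dihedral_elt n (w k) = dihedral_elt n (w l)"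
      then show "k = l"
        unfolding dihedral_elt_eq_iff w by (simp flip: mod_eq_dvd_iff)
    qed
    show "(\<lambda>k. dihedral_elt n (w k)) ` ?K = noncentral_rotations n"
    proof
      show "(\<lambda>k. dihedral_elt n (w k)) ` ?K \<subseteq> noncentral_rotations n"
        unfolding noncentral_rotations_def using w by force
      show "noncentral_rotations n \<subseteq> (\<lambda>k. dihedral_elt n (w k)) ` ?K"
      proof
        fix A assume "A \<in> noncentral_rotations n"
        then obtain v where v: "A = dihedral_elt n v" "\<not> reflection v" "\<not> int n dvd 2 * rotation v"
          unfolding noncentral_rotations_def by blast
        \<comment> \<open>Reducing the exponent modulo \<open>n\<close> changes neither the element
          nor its noncentrality.\<close>
        have "A = dihedral_elt n (w (rotation v mod int n))"
          unfolding v(1) dihedral_elt_eq_iff w using v(2) w by (simp flip: mod_eq_dvd_iff)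
        moreover have "rotation v mod int n \<in> ?K"
          using v(3) assms by (auto simp: dvd_eq_mod_eq_0 mod_mult_right_eq)
        ultimately show "A \<in> (\<lambda>k. dihedral_elt n (w k)) ` ?K" by blast
      qed
    qed
  qed
  then have "card (noncentral_rotations n) = card ?K" by (rule bij_betw_same_card[symmetric])
  also have "?K = {0..<int n} - (if even n then {0, int (n div 2)} else {0})"
  proof -
    have "int n dvd 2 * k \<longleftrightarrow> k \<in> (if even n then {0, int (n div 2)} else {0})"
      if k: "k \<in> {0..<int n}" for k
    proof
      assume "int n dvd 2 * k"
      then obtain m where m: "2 * k = int n * m" by (rule dvdE)
      \<comment> \<open>From \<open>0 \<le> 2 * k < 2 * n\<close> only the multiples
        \<open>m = 0\<close> and \<open>m = 1\<close> are left; the latter forces \<open>n\<close>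
        to be even and \<open>k\<close> to be its half.\<close>
      have "0 \<le> int n * m" using m k by simp
      then have "m \<ge> 0" using assms by (simp add: zero_le_mult_iff)
      moreover have "int n * m < int n * 2" unfolding m[symmetric] using k by simp
      then have "m < 2" by (rule mult_left_less_imp_less) simp
      ultimately have "m = 0 \<or> m = 1" by linarith
      then show "k \<in> (if even n then {0, int (n div 2)} else {0})"
      proof
        assume "m = 1"
        then have "int n = 2 * k" using m by simp
        then have "even n" "k = int (n div 2)" by presburger+
        then show ?thesis by simp
      qed (use m in simp)
    qed (auto split: if_splits)
    then show ?thesis by auto
  qed
  \<comment> \<open>Since \<open>n \<ge> 3\<close>, the half of an even \<open>n\<close> is nonzero
    and below \<open>n\<close>, so two distinct residues are removed.\<close>
  also have "card \<dots> = (if even n then n - 2 else n - 1)"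
    using assms by (auto simp: card_Diff_subset)
  finally show ?thesis .
qed

theorem proposition4p1:
  fixes n :: nat
  assumes "n \<ge> 3"
  shows "genus (commuting_graph (dihedral_group n)) =
    (if even n then genus (complete_graph (n - 2)) else genus (complete_graph (n - 1)))"
proof -
  let ?R = "noncentral_rotations n" and ?S = "reflections n" and ?M = "reflection_edges n"
  let ?E = "complete_edges ?R"
  have "finite (?R \<union> ?S)"
    unfolding noncentral_dihedral_group[OF assms, symmetric]
    using finite_carrier_dihedral_group[of n] assms by simp
  then have fin: "finite ?R" "finite ?S" by simp_all
  have E: "e \<subseteq> ?R" if "e \<in> ?E" for e using that by (auto simp: complete_edges_def)
  have finE: "finite ?E" by (rule finite_subset[of _ "Pow ?R"]) (use E fin(1) in auto)
  have M: "e \<subseteq> ?S \<and> card e = 2" if "e \<in> ?M" for e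
    using that unfolding reflection_edges_def card_2_iff by blast
  \<comment> \<open>A common element would fail to commute with itself.\<close>
  have disj: "?R \<inter> ?S = {}"
    using rotations_commute[of _ n] rotation_reflection_not_commute[of _ n] by fast
  have "embeds_in (commuting_graph (dihedral_group n)) (sphere_with_handles g) \<longleftrightarrow>
      embeds_in (complete_graph (card ?R)) (sphere_with_handles g)" for g
  proof -
    \<comment> \<open>One direction restricts the drawing to the rotations, the other redraws the
      reflections inside a free patch.\<close>
    have "embeds_in (?R, ?E) (sphere_with_handles g)"
      if "embeds_in (?R \<union> ?S, ?E \<union> ?M) (sphere_with_handles g)"
      using that by (rule embeds_in_inj_hom[where f = id]) (use E in auto)
    moreover have "embeds_in (?R \<union> ?S, ?E \<union> ?M) (sphere_with_handles g)"
      if "embeds_in (?R, ?E) (sphere_with_handles g)"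
      by (rule embeds_in_add_matching[OF that sphere_with_handles_planar_patch fin(1) finE E fin(2)
            disj M reflection_edges_matching])
    ultimately show ?thesis
      unfolding commuting_graph_dihedral_group[OF assms] embeds_in_complete_graph_iff[OF fin(1)]
      by blast
  qed
  \<comment> \<open>Both genera are the least element of one and the same predicate on
    \<open>g\<close>, so they agree without being computed.\<close>
  then have "genus (commuting_graph (dihedral_group n)) = genus (complete_graph (card ?R))"
    unfolding genus_def by simp
  then show ?thesis unfolding card_noncentral_rotations[OF assms] by simp
qed

end
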